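(* Let $\mathcal{D}\subset\mathbb{R}^n$ be compact with non-empty interior, let $g\in L(\mathcal{D})$, let $\overline{\varepsilon}\ge 0$, and let $\mathbb{D}_N^{\overline\varepsilon}(g)=\{(x_1,y_1),\dots,(x_N,y_N)\}$ be a noisy dataset generated by $g$ with noise bound $\overline\varepsilon$ and with covering radius $h(\mathbf{x},\mathcal{D})=h>0$, where $\mathbf{x}=\{x_1,\dots,x_N\}$. Pick any $\varepsilon\ge\overline\varepsilon$ and consider the problem $$\underset{f\in L(\mathcal{D})}{\text{minimize}}\ \ \mathrm{Lip}(f)\quad\text{subject to}\quad \ell(\mathbb{D}_N^{\overline\varepsilon}(g),f)\le\varepsilon. \qquad (P)$$ Then: (i) there always exists an $f^*\in L(\mathcal{D})$ that solves $(P)$; and (ii) any $f^*$ that solves $(P)$ satisfies $$\mathcal{L}(g,f^* )\le 2(l_g h+\varepsilon),$$ where $l_g=\mathrm{Lip}(g)$ is the Lipschitz constant of $g$.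
   Context: $\|\cdot\|$ denotes the Euclidean norm (absolute value on $\mathbb{R}$). For a compact set $\mathcal{D}\subset\mathbb{R}^n$ and a continuous $f:\mathcal{D}\to\mathbb{R}$, the Lipschitz semi-norm is $\mathrm{Lip}(f)=\inf\{\gamma\in[0,\infty]: \|f(x)-f(x')\|\le\gamma\|x-x'\|\ \forall x,x'\in\mathcal{D}\}$, and $L(\mathcal{D})$ is the set of $f:\mathcal{D}\to\mathbb{R}$ with $\mathrm{Lip}(f)<\infty$. We write $l_f:=\mathrm{Lip}(f)$. Given $g:\mathcal{D}\to\mathbb{R}$ and $\overline\varepsilon\ge0$, a noisy dataset generated by $g$ with noise bound $\overline\varepsilon$ is a finite set $\mathbb{D}_N^{\overline\varepsilon}(g)=\{(x_1,y_1),\dots,(x_N,y_N)\}\subset\mathcal{D}\times\mathbb{R}$ with $\|g(x_i)-y_i\|\le\overline\varepsilon$ for all $i=1,\dots,N$. The training loss is $\ell(\mathbb{D}_N^{\overline\varepsilon}(g),f)=\max_{1\le i\le N}\|y_i-f(x_i)\|$. The loss is $\mathcal{L}(f,g)=\max_{x\in\mathcal{D}}\|g(x)-f(x)\|$. For $\mathcal{D}$ compact with non-empty interior and $\mathbf{x}=\{x_1,\dots,x_N\}\subset\mathcal{D}$, the fill distance (covering radius) is $h(\mathbf{x},\mathcal{D})=\sup_{x\in\mathcal{D}}\min_{1\le i\le N}\|x-x_i\|$. *)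

theory Defs
  imports "HOL-Analysis.Analysis"
begin

text \<open>
  A function on a compact set \<open>D\<close> is represented by a total function of which only the values on
  \<open>D\<close> matter: for a dataset with inputs in \<open>D\<close>, nothing below depends on its values elsewhere.
\<close>

text \<open>
  The Lipschitz constants range over \<open>[0, \<infinity>]\<close>, so the infimum is taken in \<^typ>\<open>ennreal\<close>.
\<close>

definition Lip :: "(real ^ 'n) set \<Rightarrow> ((real ^ 'n) \<Rightarrow> real) \<Rightarrow> ennreal" where
  "Lip D f = Inf {\<gamma>. \<forall>x\<in>D. \<forall>x'\<in>D. ennreal (norm (f x - f x')) \<le> \<gamma> * ennreal (norm (x - x'))}"

definition lipschitz_functions :: "(real ^ 'n) set \<Rightarrow> ((real ^ 'n) \<Rightarrow> real) set" where
  "lipschitz_functions D = {f. Lip D f < \<infinity>}"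

text \<open>
  The dataset is a set of pairs, so the same input may occur with several outputs. It is nonempty
  (\<open>N \<ge> 1\<close>), since otherwise the maxima and minima over it would be meaningless.
\<close>

definition noisy_dataset ::
    "(real ^ 'n) set \<Rightarrow> ((real ^ 'n) \<Rightarrow> real) \<Rightarrow> real \<Rightarrow> ((real ^ 'n) \<times> real) set \<Rightarrow> bool" where
  "noisy_dataset D g e S \<longleftrightarrow>
     finite S \<and> S \<noteq> {} \<and> S \<subseteq> D \<times> UNIV \<and> (\<forall>(x, y)\<in>S. norm (g x - y) \<le> e)"

definition training_loss :: "((real ^ 'n) \<times> real) set \<Rightarrow> ((real ^ 'n) \<Rightarrow> real) \<Rightarrow> real" where
  "training_loss S f = Max ((\<lambda>(x, y). norm (y - f x)) ` S)"

text \<open>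
  The maximum over \<open>D\<close> is written as a supremum. It is attained when \<open>D\<close> is compact and nonempty
  and \<open>f\<close>, \<open>g\<close> have finite Lipschitz semi-norm, hence are continuous on \<open>D\<close>.
\<close>

definition sup_loss ::
    "(real ^ 'n) set \<Rightarrow> ((real ^ 'n) \<Rightarrow> real) \<Rightarrow> ((real ^ 'n) \<Rightarrow> real) \<Rightarrow> real" where
  "sup_loss D f g = (SUP x\<in>D. norm (g x - f x))"

definition fill_distance :: "(real ^ 'n) set \<Rightarrow> (real ^ 'n) set \<Rightarrow> real" where
  "fill_distance X D = (SUP x\<in>D. Min ((\<lambda>p. norm (x - p)) ` X))"

definition solves_min_lip ::
    "(real ^ 'n) set \<Rightarrow> ((real ^ 'n) \<times> real) set \<Rightarrow> real \<Rightarrow> ((real ^ 'n) \<Rightarrow> real) \<Rightarrow> bool" where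
  "solves_min_lip D S e =
     is_arg_min (Lip D) (\<lambda>f. f \<in> lipschitz_functions D \<and> training_loss S f \<le> e)"

end

theory Submission
  imports Defs
begin

text \<open>
  For existence, a feasible \<open>f\<close> satisfies \<open>y\<^sub>i - y\<^sub>j - 2 \<epsilon> \<le> Lip f * norm (x\<^sub>i - x\<^sub>j)\<close> for all \<open>i\<close>, \<open>j\<close>,
  and these finitely many inequalities survive in the infimum \<open>c\<close> of the feasible Lipschitz constants.
  Conversely, they make the \<open>c\<close>-Lipschitz function \<open>x \<mapsto> min\<^sub>i (y\<^sub>i + \<epsilon> + c * norm (x - x\<^sub>i))\<close> feasible
  (McShane extension of the upper ends of the error bars), so it is optimal. For the bound, \<open>g\<close> itself
  is feasible, so \<open>Lip f \<le> Lip g\<close> for any solution \<open>f\<close>; compare \<open>f\<close> and \<open>g\<close> at the nearest data point.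
\<close>

lemma Lip_leI:
  assumes "0 \<le> c" and "\<And>x x'. x \<in> D \<Longrightarrow> x' \<in> D \<Longrightarrow> \<bar>f x - f x'\<bar> \<le> c * norm (x - x')"
  shows "Lip D f \<le> ennreal c"
  unfolding Lip_def
proof (rule Inf_lower, intro CollectI ballI)
  fix x x' assume "x \<in> D" "x' \<in> D"
  with assms have "ennreal \<bar>f x - f x'\<bar> \<le> ennreal (c * norm (x - x'))"
    by (intro ennreal_leI)
  then show "ennreal (norm (f x - f x')) \<le> ennreal c * ennreal (norm (x - x'))"
    using assms(1) by (simp add: ennreal_mult)
qed

text \<open>Every admissible \<open>\<gamma>\<close> dominates the difference quotient, hence so
  does their infimum, which is therefore admissible itself. Finiteness matters because
  \<open>enn2real\<close> sends \<infinity> to 0.\<close>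

lemma Lip_bound:
  assumes f: "f \<in> lipschitz_functions D" and x: "x \<in> D" and x': "x' \<in> D"
  shows "\<bar>f x - f x'\<bar> \<le> enn2real (Lip D f) * norm (x - x')"
proof (cases "x = x'")
  case False
  define d where "d = norm (x - x')"
  have d: "d > 0" using False by (simp add: d_def)
  have "ennreal (\<bar>f x - f x'\<bar> / d) \<le> Lip D f"
    unfolding Lip_def
  proof (rule Inf_greatest)
    fix \<gamma> :: ennreal
    assume "\<gamma> \<in> {\<gamma>. \<forall>x\<in>D. \<forall>x'\<in>D. ennreal (norm (f x - f x')) \<le> \<gamma> * ennreal (norm (x - x'))}"
    then have le: "ennreal \<bar>f x - f x'\<bar> \<le> \<gamma> * ennreal d"
      using x x' by (auto simp: d_def)
    show "ennreal (\<bar>f x - f x'\<bar> / d) \<le> \<gamma>"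
    proof (cases \<gamma>)
      case (real r)
      then have "ennreal \<bar>f x - f x'\<bar> \<le> ennreal (r * d)"
        using le d by (simp add: ennreal_mult)
      then have "\<bar>f x - f x'\<bar> \<le> r * d"
        using real d by (simp add: ennreal_le_iff)
      then show ?thesis
        using real d by (auto intro!: ennreal_leI simp: field_simps)
    qed simp
  qed
  moreover have "Lip D f < top"
    using f by (simp add: lipschitz_functions_def)
  ultimately have "\<bar>f x - f x'\<bar> / d \<le> enn2real (Lip D f)"
    using d enn2real_mono[of "ennreal (\<bar>f x - f x'\<bar> / d)" "Lip D f"] by simp
  then show ?thesis using d by (simp add: field_simps d_def)
qed simp

lemma training_loss_le_iff:
  assumes "finite S" "S \<noteq> {}"
  shows "training_loss S f \<le> e \<longleftrightarrow> (\<forall>(x, y)\<in>S. \<bar>y - f x\<bar> \<le> e)"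
  using assms by (auto simp: training_loss_def)

text \<open>Used to see that a pointwise minimum of finitely many \<open>c\<close>-Lipschitz
  functions is again \<open>c\<close>-Lipschitz. A one-sided bound is applied twice, with
  \<open>a\<close> and \<open>b\<close> swapped.\<close>

lemma Min_image_dist_le:
  fixes a b :: "'b \<Rightarrow> real"
  assumes S: "finite S" "S \<noteq> {}"
    and ab: "\<And>p. p \<in> S \<Longrightarrow> \<bar>a p - b p\<bar> \<le> e"
  shows "\<bar>Min (a ` S) - Min (b ` S)\<bar> \<le> e"
proof -
  have "Min (a ` S) - e \<le> Min (b ` S)"
    if ab: "\<And>p. p \<in> S \<Longrightarrow> \<bar>a p - b p\<bar> \<le> e" for a b :: "'b \<Rightarrow> real"
  proof (rule Min.boundedI)
    fix v assume "v \<in> b ` S"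
    then obtain p where p: "p \<in> S" "v = b p" by auto
    have "Min (a ` S) \<le> a p"
      using S p by (intro Min_le) auto
    then show "Min (a ` S) - e \<le> v"
      using ab[OF p(1)] p(2) by linarith
  qed (use S in auto)
  from this[of a b] this[of b a] ab show ?thesis
    by (force simp: abs_minus_commute abs_le_iff)
qed

lemma solves_min_lip_exists:
  fixes D :: "(real ^ 'n) set"
  assumes S: "finite S" "S \<noteq> {}" "S \<subseteq> D \<times> UNIV"
    and g: "g \<in> lipschitz_functions D" "training_loss S g \<le> e"
  shows "\<exists>f. solves_min_lip D S e f"
proof -
  define F where "F = {f \<in> lipschitz_functions D. training_loss S f \<le> e}"
  \<comment> \<open>All members of \<open>F\<close> have finite Lipschitz constant, so the infimum
    can be taken in the reals.\<close>
  define c where "c = (INF f\<in>F. enn2real (Lip D f))"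
  have F: "F \<noteq> {}" using g by (auto simp: F_def)
  have c0: "0 \<le> c" unfolding c_def by (intro cINF_greatest F) simp
  have gap: "y - y' - 2 * e \<le> c * norm (x - x')" if xy: "(x, y) \<in> S" "(x', y') \<in> S" for x y x' y'
  proof -
    have le: "y - y' - 2 * e \<le> enn2real (Lip D f) * norm (x - x')" if "f \<in> F" for f
    proof -
      have "\<bar>f x - f x'\<bar> \<le> enn2real (Lip D f) * norm (x - x')"
        using that xy S by (intro Lip_bound) (auto simp: F_def)
      moreover have "\<bar>y - f x\<bar> \<le> e" "\<bar>y' - f x'\<bar> \<le> e"
        using that xy S by (auto simp: F_def training_loss_le_iff)
      ultimately show ?thesis by linarith
    qed
    show ?thesis
    \<comment> \<open>For equal inputs the distance is 0 and a single feasible function suffices.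
      Otherwise, dividing by the distance gives a lower bound on every feasible Lipschitz constant,
      which passes to the infimum.\<close>
    proof (cases "x = x'")
      case True
      then show ?thesis using le F by auto
    next
      case False
      then have "(y - y' - 2 * e) / norm (x - x') \<le> c"
        unfolding c_def using le by (intro cINF_greatest F) (simp add: divide_le_eq)
      then show ?thesis using False by (simp add: divide_le_eq)
    qed
  qed
  \<comment> \<open>A cone of slope \<open>c\<close> with apex at the upper end \<open>y + e\<close>
    of the error bar over \<open>p\<close>.\<close>
  define u where "u = (\<lambda>(p :: real ^ 'n, y) x. y + e + c * norm (x - p))"
  define f where "f x = Min ((\<lambda>p. u p x) ` S)" for x
  have "Lip D f \<le> ennreal c"
  proof (rule Lip_leI[OF c0])
    fix x x' :: "real ^ 'n"
    show "\<bar>f x - f x'\<bar> \<le> c * norm (x - x')"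
      unfolding f_def
    proof (rule Min_image_dist_le[OF S(1,2)])
      fix p :: "(real ^ 'n) \<times> real"
      \<comment> \<open>Each cone is \<open>c\<close>-Lipschitz by the reverse triangle
        inequality.\<close>
      have "c * \<bar>norm (x - fst p) - norm (x' - fst p)\<bar> \<le> c * norm (x - x')"
        using c0 norm_triangle_ineq3[of "x - fst p" "x' - fst p"]
        by (intro mult_left_mono) auto
      moreover have "\<bar>u p x - u p x'\<bar> = c * \<bar>norm (x - fst p) - norm (x' - fst p)\<bar>"
        using c0 by (simp add: u_def split_def abs_mult flip: right_diff_distrib)
      ultimately show "\<bar>u p x - u p x'\<bar> \<le> c * norm (x - x')" by simp
    qed
  qed
  moreover from this have "f \<in> lipschitz_functions D"
    by (auto simp: lipschitz_functions_def intro: le_less_trans)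
  moreover have "training_loss S f \<le> e"
    unfolding training_loss_le_iff[OF S(1,2)]
  proof clarify
    fix x y assume xy: "(x, y) \<in> S"
    \<comment> \<open>The cone over \<open>x\<close> itself takes the value \<open>y + e\<close>
      there.\<close>
    have "f x \<le> u (x, y) x"
      unfolding f_def using S xy by (intro Min_le) auto
    \<comment> \<open>No other cone dips below the error bar at \<open>x\<close>: this is exactly
      \<open>gap\<close>.\<close>
    moreover have "y - e \<le> f x"
      unfolding f_def using S gap[OF xy] by (intro Min.boundedI) (fastforce simp: u_def)+
    ultimately show "\<bar>y - f x\<bar> \<le> e" by (auto simp: u_def)
  qed
  moreover have "ennreal c \<le> Lip D f'" if "f' \<in> F" for f'
  proof -
    have "c \<le> enn2real (Lip D f')"
      unfolding c_def by (intro cINF_lower that bdd_belowI2[where m = 0]) simp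
    then show ?thesis
      using that by (auto simp: F_def lipschitz_functions_def ennreal_enn2real dest!: ennreal_leI)
  qed
  ultimately have "solves_min_lip D S e f"
    unfolding solves_min_lip_def is_arg_min_def F_def
    by (auto simp: not_less intro: order_trans)
  then show ?thesis by blast
qed

text \<open>The minimum over the finite \<open>X\<close> is attained, which gives \<open>p\<close>.
  A real supremum dominates its terms only if they are bounded above; boundedness of
  \<open>D\<close> and one fixed \<open>q\<close> in \<open>X\<close> ensure this.\<close>

lemma fill_distance_near:
  assumes "bounded D" "finite X" "X \<noteq> {}" "x \<in> D"
  obtains p where "p \<in> X" "norm (x - p) \<le> fill_distance X D"
proof -
  let ?m = "\<lambda>x. Min ((\<lambda>p. norm (x - p)) ` X)"
  obtain q where q: "q \<in> X" using assms by blast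
  obtain B where B: "\<And>x. x \<in> D \<Longrightarrow> norm x \<le> B"
    using assms(1) by (auto simp: bounded_iff)
  have "?m z \<le> B + norm q" if "z \<in> D" for z
  proof -
    have "?m z \<le> norm (z - q)" using assms q by (intro Min_le) auto
    also have "\<dots> \<le> B + norm q" using norm_triangle_ineq4[of z q] B[OF that] by linarith
    finally show ?thesis .
  qed
  then have "bdd_above (?m ` D)" by (rule bdd_aboveI2)
  then have "?m x \<le> fill_distance X D"
    unfolding fill_distance_def by (intro cSUP_upper assms)
  moreover have "?m x \<in> (\<lambda>p. norm (x - p)) ` X"
    using assms by (intro Min_in) auto
  ultimately show ?thesis using that by auto
qed

theorem theorem1:
  fixes D :: "(real ^ 'n) set"
    and g :: "(real ^ 'n) \<Rightarrow> real"
    and S :: "((real ^ 'n) \<times> real) set"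
    and noise_bound h \<epsilon> :: real
  assumes "compact D"
    and "interior D \<noteq> {}"
    and "g \<in> lipschitz_functions D"
    and "noise_bound \<ge> 0"
    and "noisy_dataset D g noise_bound S"
    and "fill_distance (fst ` S) D = h"
    and "h > 0"
    and "\<epsilon> \<ge> noise_bound"
  shows "(\<exists>f. solves_min_lip D S \<epsilon> f) \<and>
         (\<forall>f. solves_min_lip D S \<epsilon> f \<longrightarrow>
            sup_loss D g f \<le> 2 * (enn2real (Lip D g) * h + \<epsilon>))"
proof -
  \<comment> \<open>The noise bound is relaxed to \<open>\<epsilon>\<close> at once, since this
    makes \<open>g\<close> feasible.\<close>
  have S: "finite S" "S \<noteq> {}" "S \<subseteq> D \<times> UNIV"
    and noise: "\<And>x y. (x, y) \<in> S \<Longrightarrow> \<bar>y - g x\<bar> \<le> \<epsilon>"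
    using assms(5,8) by (fastforce simp: noisy_dataset_def abs_minus_commute)+
  have g: "training_loss S g \<le> \<epsilon>"
    using noise by (auto simp: training_loss_le_iff[OF S(1,2)])
  have "sup_loss D g f \<le> 2 * (enn2real (Lip D g) * h + \<epsilon>)" if "solves_min_lip D S \<epsilon> f" for f
  proof -
    have f: "f \<in> lipschitz_functions D" "training_loss S f \<le> \<epsilon>" "Lip D f \<le> Lip D g"
      using that g assms(3) by (auto simp: solves_min_lip_def is_arg_min_def not_less)
    \<comment> \<open>Passing to the reals preserves the order because \<open>Lip D g\<close> is
      finite.\<close>
    have Lip_le: "enn2real (Lip D f) \<le> enn2real (Lip D g)"
      using f(3) assms(3) by (intro enn2real_mono) (auto simp: lipschitz_functions_def)
    show ?thesis
      unfolding sup_loss_def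
    proof (rule cSUP_least)
      show "D \<noteq> {}" using assms(2) by auto
    next
      fix x assume x: "x \<in> D"
      obtain p where p: "p \<in> fst ` S" "norm (x - p) \<le> h"
        using fill_distance_near[of D "fst ` S" x] S x assms(6) compact_imp_bounded[OF assms(1)]
        by auto
      then obtain y where y: "(p, y) \<in> S" by auto
      then have pD: "p \<in> D" using S by auto
      have "\<bar>g x - g p\<bar> \<le> enn2real (Lip D g) * norm (x - p)"
        by (rule Lip_bound[OF assms(3) x pD])
      also have "\<dots> \<le> enn2real (Lip D g) * h"
        using p by (intro mult_left_mono) auto
      finally have "\<bar>g x - g p\<bar> \<le> enn2real (Lip D g) * h" .
      moreover have "\<bar>f x - f p\<bar> \<le> enn2real (Lip D f) * norm (x - p)"
        by (rule Lip_bound[OF f(1) x pD])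
      moreover have "\<dots> \<le> enn2real (Lip D g) * h"
        using p Lip_le by (intro mult_mono) auto
      moreover have "\<bar>y - f p\<bar> \<le> \<epsilon>"
        using f(2) y by (auto simp: training_loss_le_iff[OF S(1,2)])
      \<comment> \<open>Triangle inequality along \<open>f x\<close>, \<open>f p\<close>,
        \<open>y\<close>, \<open>g p\<close>, \<open>g x\<close>: the two outer steps cost at most
        \<open>enn2real (Lip D g) * h\<close> each, the two inner ones at most
        \<open>\<epsilon>\<close> each.\<close>
      ultimately show "norm (f x - g x) \<le> 2 * (enn2real (Lip D g) * h + \<epsilon>)"
        using noise[OF y] by simp
    qed
  qed
  with solves_min_lip_exists[OF S assms(3) g] show ?thesis by blast
qed

end
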